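(* Let $d\ge 2$ and $1\le p < d$ be integers. Then $Q_d^{[\natural p]}$ is connected if and only if $p$ is odd.
   Context: The hypercube $Q_d$ has vertex set $\{0,1\}^d$, two vertices adjacent iff they differ in exactly one coordinate. For a graph $G$ and positive integer $p$, $G^{[\natural p]}$ is the graph on $V(G)$ in which two vertices are adjacent iff their distance in $G$ is exactly $p$ (for $Q_d$: iff they differ in exactly $p$ coordinates). *)

theory Defs
  imports "Graph_Theory.Graph_Theory"
begin

text \<open>
  Undirected graphs are symmetric digraphs, as usual in \<^theory>\<open>Graph_Theory.Graph_Theory\<close>.
  The vertex set $\{0,1\}^d$ consists of the Boolean lists of length $d$.
\<close>

definition hypercube :: "nat \<Rightarrow> bool list pair_pre_digraph" where
  "hypercube d = \<lparr>
     pverts = {x. length x = d},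
     parcs = {(x, y). length x = d \<and> length y = d \<and> card {i. i < d \<and> x ! i \<noteq> y ! i} = 1} \<rparr>"

text \<open>
  Graph distance is the infimum of the lengths of the walks between two vertices, that is,
  the minimal walk cost for unit arc weights; it is infinite if there is no such walk.
\<close>

definition graph_dist :: "'a pair_pre_digraph \<Rightarrow> 'a \<Rightarrow> 'a \<Rightarrow> ereal" where
  "graph_dist G u v = wf_digraph.\<mu> (with_proj G) (\<lambda>_. 1) u v"

definition exact_distance_graph :: "'a pair_pre_digraph \<Rightarrow> nat \<Rightarrow> 'a pair_pre_digraph" where
  "exact_distance_graph G p = \<lparr>
     pverts = pverts G,
     parcs = {(u, v). u \<in> pverts G \<and> v \<in> pverts G \<and> graph_dist G u v = ereal (real p)} \<rparr>"

lemma pverts_hypercube: "pverts (hypercube d) = {x. length x = d}"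
  by (simp add: hypercube_def)

lemma pair_graph_hypercube: "pair_graph (hypercube d)"
proof
  show "finite (pverts (hypercube d))"
    using finite_lists_length_eq[of "UNIV :: bool set" d] by (simp add: hypercube_def)
  then have "finite (pverts (hypercube d) \<times> pverts (hypercube d))" by simp
  then show "finite (parcs (hypercube d))"
    by (rule rev_finite_subset) (auto simp: hypercube_def)
  show "symmetric (with_proj (hypercube d))"
  proof -
    have "card {i. i < d \<and> y ! i \<noteq> x ! i} = 1" if "card {i. i < d \<and> x ! i \<noteq> y ! i} = 1"
      for x y :: "bool list"
    proof -
      have "{i. i < d \<and> y ! i \<noteq> x ! i} = {i. i < d \<and> x ! i \<noteq> y ! i}" by (rule Collect_cong) blast
      then show ?thesis using that by (rule ssubst)
    qed
    then show ?thesis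
      by (simp only: symmetric_def sym_def with_proj_simps) (simp add: hypercube_def)
  qed
next
  fix e assume e: "e \<in> parcs (hypercube d)"
  show "fst e \<in> pverts (hypercube d)" "snd e \<in> pverts (hypercube d)"
    using e by (simp_all add: hypercube_def case_prod_unfold)
  show "fst e \<noteq> snd e"
    using e by (cases "fst e = snd e") (simp_all add: hypercube_def case_prod_unfold)
qed

lemma hypercube_walk_ge:
  assumes "pre_digraph.awalk (with_proj (hypercube d)) x w y"
  shows "card {i. i < d \<and> x ! i \<noteq> y ! i} \<le> length w"
proof -
  interpret pair_graph "hypercube d" by (rule pair_graph_hypercube)
  show ?thesis using assms
  proof (induction w arbitrary: x)
    case Nil
    then show ?case by (simp add: awalk_Nil_iff)
  next
    case (Cons e w)
    obtain z where e: "e = (x, z)" and a: "(x, z) \<in> parcs (hypercube d)" and w: "awalk z w y"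
      using Cons.prems by (cases e) (auto simp: awalk_Cons_iff)
    have "{i. i < d \<and> x ! i \<noteq> y ! i} \<subseteq>
        {i. i < d \<and> x ! i \<noteq> z ! i} \<union> {i. i < d \<and> z ! i \<noteq> y ! i}" by auto
    then have "card {i. i < d \<and> x ! i \<noteq> y ! i} \<le>
        card ({i. i < d \<and> x ! i \<noteq> z ! i} \<union> {i. i < d \<and> z ! i \<noteq> y ! i})"
      by (intro card_mono) auto
    also have "\<dots> \<le> card {i. i < d \<and> x ! i \<noteq> z ! i} + card {i. i < d \<and> z ! i \<noteq> y ! i}"
      by (rule card_Un_le)
    also have "card {i. i < d \<and> x ! i \<noteq> z ! i} = 1"
      using a by (simp add: hypercube_def)
    also have "1 + card {i. i < d \<and> z ! i \<noteq> y ! i} \<le> length (e # w)"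
      using Cons.IH[OF w] by simp
    finally show ?case by simp
  qed
qed

lemma hypercube_walk_exists:
  assumes "length x = d" "length y = d"
  shows "\<exists>w. pre_digraph.awalk (with_proj (hypercube d)) x w y \<and>
    length w = card {i. i < d \<and> x ! i \<noteq> y ! i}"
proof -
  interpret pair_graph "hypercube d" by (rule pair_graph_hypercube)
  show ?thesis using assms
  proof (induction "card {i. i < d \<and> x ! i \<noteq> y ! i}" arbitrary: x)
    case 0
    then have "{i. i < d \<and> x ! i \<noteq> y ! i} = {}" by simp
    then have "x = y" using 0 by (auto intro: nth_equalityI)
    then show ?case using 0 by (intro exI[of _ "[]"]) (auto simp: awalk_Nil_iff pverts_hypercube)
  next
    case (Suc n)
    then have "{i. i < d \<and> x ! i \<noteq> y ! i} \<noteq> {}" by (metis card.empty nat.distinct(1))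
    then obtain j where j: "j < d" "x ! j \<noteq> y ! j" by auto
    define z where "z = x[j := y ! j]"
    have z: "length z = d" using Suc by (simp add: z_def)
    have zy: "{i. i < d \<and> z ! i \<noteq> y ! i} = {i. i < d \<and> x ! i \<noteq> y ! i} - {j}"
      using j Suc by (auto simp: z_def nth_list_update)
    then have c: "n = card {i. i < d \<and> z ! i \<noteq> y ! i}"
      using Suc.hyps(2) j by (simp add: card_Diff_singleton_if)
    obtain w where w: "awalk z w y" "length w = card {i. i < d \<and> z ! i \<noteq> y ! i}"
      using Suc.hyps(1)[OF c z] Suc.prems by blast
    have "{i. i < d \<and> x ! i \<noteq> z ! i} = {j}"
      using j Suc by (auto simp: z_def nth_list_update split: if_splits)
    then have "(x, z) \<in> parcs (hypercube d)" using Suc.prems z by (simp add: hypercube_def)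
    then show ?case using w c Suc.hyps(2)
      by (intro exI[of _ "(x, z) # w"]) (auto simp: awalk_Cons_iff)
  qed
qed

lemma graph_dist_hypercube:
  assumes "length x = d" "length y = d"
  shows "graph_dist (hypercube d) x y = ereal (real (card {i. i < d \<and> x ! i \<noteq> y ! i}))"
proof -
  interpret pair_graph "hypercube d" by (rule pair_graph_hypercube)
  have cost: "awalk_cost (\<lambda>_. 1) w = real (length w)" for w
    by (induction w) auto
  obtain w where w: "awalk x w y" "length w = card {i. i < d \<and> x ! i \<noteq> y ! i}"
    using hypercube_walk_exists[OF assms] by blast
  show ?thesis unfolding graph_dist_def \<mu>_def cost
  proof (rule antisym)
    show "(INF p\<in>{p. awalk x p y}. ereal (real (length p)))
        \<le> ereal (real (card {i. i < d \<and> x ! i \<noteq> y ! i}))"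
      using w by (intro INF_lower2[of w]) auto
    show "ereal (real (card {i. i < d \<and> x ! i \<noteq> y ! i}))
        \<le> (INF p\<in>{p. awalk x p y}. ereal (real (length p)))"
      by (intro INF_greatest) (auto dest: hypercube_walk_ge)
  qed
qed

lemma exact_distance_graph_hypercube:
  "exact_distance_graph (hypercube d) p = \<lparr>
     pverts = {x. length x = d},
     parcs = {(x, y). length x = d \<and> length y = d \<and> card {i. i < d \<and> x ! i \<noteq> y ! i} = p} \<rparr>"
proof -
  have "graph_dist (hypercube d) x y = ereal (real p) \<longleftrightarrow>
      card {i. i < d \<and> x ! i \<noteq> y ! i} = p" if "length x = d" "length y = d" for x y
    unfolding graph_dist_hypercube[OF that] by (simp only: ereal.inject of_nat_eq_iff)
  then have "{(x, y). length x = d \<and> length y = d \<and> graph_dist (hypercube d) x y = ereal (real p)} =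
      {(x, y). length x = d \<and> length y = d \<and> card {i. i < d \<and> x ! i \<noteq> y ! i} = p}"
    by blast
  then show ?thesis
    by (simp only: exact_distance_graph_def pverts_hypercube mem_Collect_eq)
qed

end

theory Submission
  imports Defs
begin

text \<open>
  Adjacent vertices of the exact distance graph differ by flipping a set of \<open>p\<close> coordinates.
  If \<open>p\<close> is even, the parity of the Hamming distance to a fixed vertex is invariant along edges.
  If \<open>p\<close> is odd, flipping \<open>insert a C\<close> and then \<open>insert b C\<close>, where \<open>C\<close> has \<open>p - 1\<close>
  elements and avoids \<open>a\<close> and \<open>b\<close> (possible because \<open>p < d\<close>), flips exactly \<open>a\<close> and \<open>b\<close>; hence
  all sets of even size can be flipped. Flipping a \<open>p\<close>-set containing \<open>i\<close> and then that set
  without \<open>i\<close> flips \<open>i\<close> alone.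
\<close>

text \<open>Addition of the indicator vector of \<open>S\<close> over the two-element field, with
  \<open>\<noteq>\<close> as exclusive or. Composition of flips thus becomes symmetric difference of
  sets.\<close>

definition flip :: "nat set \<Rightarrow> bool list \<Rightarrow> bool list" where
  "flip S x = map (\<lambda>i. x ! i \<noteq> (i \<in> S)) [0..<length x]"

lemma length_flip [simp]: "length (flip S x) = length x"
  by (simp add: flip_def)

lemma nth_flip [simp]: "i < length x \<Longrightarrow> flip S x ! i \<longleftrightarrow> x ! i \<noteq> (i \<in> S)"
  by (simp add: flip_def)

lemma flip_empty [simp]: "flip {} x = x"
  by (rule nth_equalityI) auto

lemma flip_flip: "flip A (flip B x) = flip (sym_diff A B) x"
  by (rule nth_equalityI) auto

lemma flip_differing:
  assumes "length x = length y"
  shows "flip {i. i < length x \<and> x ! i \<noteq> y ! i} x = y"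
  using assms by (intro nth_equalityI) auto

lemma differing_flip:
  assumes "S \<subseteq> {..<length x}"
  shows "{i. i < length x \<and> x ! i \<noteq> flip S x ! i} = S"
  using assms by auto

text \<open>\<open>card A + card B\<close> counts \<open>A \<inter> B\<close> twice and the
  symmetric difference omits it, which leaves the parity unchanged.\<close>

lemma even_card_sym_diff:
  assumes "finite A" "finite B"
  shows "even (card (sym_diff A B)) \<longleftrightarrow> even (card A + card B)"
proof -
  have "card A = card (A - B) + card (A \<inter> B)" "card B = card (B - A) + card (A \<inter> B)"
    using assms by (metis Int_commute Diff_disjoint Int_Diff_disjoint Int_Diff_Un
      add.commute card_Un_disjoint finite_Diff finite_Int)+
  moreover have "card (sym_diff A B) = card (A - B) + card (B - A)"
    using assms by (intro card_Un_disjoint) auto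
  ultimately show ?thesis by auto
qed

lemma even_differing_trans:
  assumes "even (card {i. i < d \<and> x ! i \<noteq> y ! i})" "even (card {i. i < d \<and> y ! i \<noteq> z ! i})"
  shows "even (card {i. i < (d::nat) \<and> x ! i \<noteq> (z :: bool list) ! i})"
proof -
  have "{i. i < d \<and> x ! i \<noteq> z ! i} =
      sym_diff {i. i < d \<and> x ! i \<noteq> y ! i} {i. i < d \<and> y ! i \<noteq> z ! i}" by auto
  then show ?thesis using assms by (simp only: even_card_sym_diff finite_Collect_less_nat
        finite_Collect_conjI simp_thms even_add)
qed

text \<open>A nonempty set of even size contains two distinct elements, which are removed together.
  The step uses \<open>sym_diff\<close> instead of a union so that it matches the composition of
  flips.\<close>

lemma even_subset_induct [consumes 2, case_names empty sym_diff]: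
  assumes "finite S" "even (card S)"
    and "P {}"
    and "\<And>a b T. a \<in> S \<Longrightarrow> b \<in> S \<Longrightarrow> a \<noteq> b \<Longrightarrow> P T \<Longrightarrow> P (sym_diff {a, b} T)"
  shows "P S"
  using assms
proof (induction "card S" arbitrary: S rule: less_induct)
  case less
  show ?case
  proof (cases "S = {}")
    case False
    then obtain a where a: "a \<in> S" by auto
    have "card (S - {a}) = card S - 1" using a by simp
    moreover have "card S > 0" using less.prems(1) False by (simp add: card_gt_0_iff)
    ultimately have "odd (card (S - {a}))" using less.prems(2) by simp
    then have "S - {a} \<noteq> {}" by (metis card.empty even_zero)
    then obtain b where b: "b \<in> S" "a \<noteq> b" by auto
    have card: "card S = card (S - {a, b}) + 2"
      using card_Diff_subset[of "{a, b}" S] card_mono[OF less.prems(1), of "{a, b}"] a b by simp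
    have "P (S - {a, b})"
    proof (rule less.hyps)
      show "card (S - {a, b}) < card S" "even (card (S - {a, b}))"
        using card less.prems(2) by simp_all
    qed (use less.prems(1,3) in simp_all, use less.prems(4) in blast)
    then have "P (sym_diff {a, b} (S - {a, b}))" using less.prems(4) a b by blast
    moreover have "sym_diff {a, b} (S - {a, b}) = S" using a b by auto
    ultimately show ?thesis by simp
  qed (use less.prems in simp)
qed

text \<open>Quantifying over every start vertex \<open>x\<close> lets flips be chained: the second
  one starts at the vertex that the first one reaches.\<close>

definition flippable :: "nat \<Rightarrow> nat \<Rightarrow> nat set \<Rightarrow> bool" where
  "flippable d p S \<longleftrightarrow>
    (\<forall>x. length x = d \<longrightarrow> x \<rightarrow>\<^sup>*\<^bsub>with_proj (exact_distance_graph (hypercube d) p)\<^esub> flip S x)"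

lemma flippable_empty: "flippable d p {}"
  by (auto simp: flippable_def reachable_def exact_distance_graph_hypercube)

lemma flippable_sym_diff:
  assumes "flippable d p A" "flippable d p B"
  shows "flippable d p (sym_diff A B)"
  using assms unfolding flippable_def flip_flip[symmetric] reachable_def
  by (metis length_flip rtrancl_on_trans)

text \<open>Such a flip is a single edge; these sets generate all other flippable sets under
  symmetric difference.\<close>

lemma flippable_card:
  assumes "S \<subseteq> {..<d}" "card S = p"
  shows "flippable d p S"
  unfolding flippable_def
proof (intro allI impI)
  fix x :: "bool list" assume x: "length x = d"
  have "card {i. i < d \<and> x ! i \<noteq> flip S x ! i} = p"
    using differing_flip[of S x] assms x by simp
  then have "(x, flip S x) \<in> arcs_ends (with_proj (exact_distance_graph (hypercube d) p))"
    using x by (simp add: exact_distance_graph_hypercube arcs_ends_def arc_to_ends_def)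
  then show "x \<rightarrow>\<^sup>*\<^bsub>with_proj (exact_distance_graph (hypercube d) p)\<^esub> flip S x"
    unfolding reachable_def
    by (rule rtrancl_on_into_rtrancl_on[rotated])
      (simp_all add: x exact_distance_graph_hypercube)
qed

lemma flippable_pair:
  assumes "1 \<le> p" "p < d" "a < d" "b < d" "a \<noteq> b"
  shows "flippable d p {a, b}"
proof -
  have "p - 1 \<le> card ({..<d} - {a, b})"
    using assms by (subst card_Diff_subset) auto
  then obtain C where C: "C \<subseteq> {..<d} - {a, b}" "card C = p - 1" "finite C"
    by (rule obtain_subset_with_card_n)
  have "a \<notin> C" "b \<notin> C" using C(1) by auto
  then have "card (insert a C) = p" "card (insert b C) = p"
    using assms C by simp_all
  then have "flippable d p (sym_diff (insert a C) (insert b C))"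
    using C assms by (intro flippable_sym_diff flippable_card) auto
  moreover have "sym_diff (insert a C) (insert b C) = {a, b}"
    using \<open>a \<notin> C\<close> \<open>b \<notin> C\<close> \<open>a \<noteq> b\<close> by auto
  ultimately show ?thesis by simp
qed

lemma flippable_even:
  assumes "1 \<le> p" "p < d" "S \<subseteq> {..<d}" "even (card S)"
  shows "flippable d p S"
proof -
  have "finite S" using assms(3) by (rule finite_subset) simp
  then show ?thesis using assms(4)
  proof (induction rule: even_subset_induct)
    case empty
    show ?case by (rule flippable_empty)
  next
    case (sym_diff a b T)
    then show ?case using assms by (intro flippable_sym_diff flippable_pair) auto
  qed
qed

lemma flippable_singleton:
  assumes "odd p" "p < d" "i < d"
  shows "flippable d p {i}"
proof -
  have "p - 1 \<le> card ({..<d} - {i})" using assms by simp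
  then obtain C where C: "C \<subseteq> {..<d} - {i}" "card C = p - 1" "finite C"
    by (rule obtain_subset_with_card_n)
  have "i \<notin> C" using C(1) by auto
  have "1 \<le> p" using assms(1) by (rule odd_pos[THEN Suc_leI, folded One_nat_def])
  have "flippable d p (sym_diff C (insert i C))"
  proof (rule flippable_sym_diff)
    \<comment> \<open>The parity of \<open>p\<close> is decisive here: \<open>C\<close> has
      \<open>p - 1\<close> elements, an even number.\<close>
    show "flippable d p C" using C assms \<open>1 \<le> p\<close> by (intro flippable_even) auto
    show "flippable d p (insert i C)"
      using C assms \<open>1 \<le> p\<close> \<open>i \<notin> C\<close> by (intro flippable_card) auto
  qed
  moreover have "sym_diff C (insert i C) = {i}" using \<open>i \<notin> C\<close> by auto
  ultimately show ?thesis by simp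
qed

text \<open>Every finite set is a symmetric difference of its singletons.\<close>

lemma flippable_odd:
  assumes "odd p" "p < d" "S \<subseteq> {..<d}"
  shows "flippable d p S"
proof -
  have "finite S" using assms(3) by (rule finite_subset) simp
  then show ?thesis using assms(3)
  proof (induction S rule: finite_induct)
    case empty
    show ?case by (rule flippable_empty)
  next
    case (insert i S)
    have "flippable d p (sym_diff {i} S)"
      using insert assms by (intro flippable_sym_diff flippable_singleton) auto
    moreover have "sym_diff {i} S = insert i S" using insert.hyps by auto
    ultimately show ?case by simp
  qed
qed

text \<open>Each edge changes an even number of coordinates. The relation is the symmetric closure
  because connectedness is expressed through it.\<close>

lemma even_differing_if_connected:
  assumes "even p"
    and "(u, v) \<in> rtrancl_on F ((arcs_ends (with_proj (exact_distance_graph (hypercube d) p)))\<^sup>s)"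
  shows "even (card {i. i < d \<and> u ! i \<noteq> v ! i})"
  using assms(2)
proof (induction rule: rtrancl_on_induct)
  case base
  show ?case by simp
next
  case (step y z)
  \<comment> \<open>A step of the symmetric closure may traverse an arc backwards, so both orders of
    the endpoints occur.\<close>
  have "{i. i < d \<and> y ! i \<noteq> z ! i} = {i. i < d \<and> z ! i \<noteq> y ! i}" by auto
  then have "card {i. i < d \<and> y ! i \<noteq> z ! i} = p"
    using step.hyps(2)
    by (auto simp: symcl_def arcs_ends_def arc_to_ends_def exact_distance_graph_hypercube)
  then show ?case using step.IH \<open>even p\<close> by (intro even_differing_trans[of d u y z]) simp_all
qed

theorem theorem3p5:
  fixes d p :: nat
  assumes "2 \<le> d" and "1 \<le> p" and "p < d"
  shows "Digraph_Component.connected (with_proj (exact_distance_graph (hypercube d) p)) \<longleftrightarrow> odd p"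
proof -
  let ?G = "with_proj (exact_distance_graph (hypercube d) p)"
  have verts: "verts ?G = {x. length x = d}"
    by (simp add: exact_distance_graph_hypercube)
  show ?thesis
  proof
    assume conn: "Digraph_Component.connected ?G"
    show "odd p"
    proof
      assume "even p"
      \<comment> \<open>Two vertices that differ in coordinate 0 only, hence at odd Hamming distance
        1.\<close>
      let ?u = "replicate d False"
      let ?v = "flip {0} ?u"
      have "(?u, ?v) \<in> rtrancl_on (verts ?G) ((arcs_ends ?G)\<^sup>s)"
        using conn unfolding connected_conv verts by simp
      then have "even (card {i. i < d \<and> ?u ! i \<noteq> ?v ! i})"
        using \<open>even p\<close> by (rule even_differing_if_connected[rotated])
      moreover have "{i. i < d \<and> ?u ! i \<noteq> ?v ! i} = {0}"
        using differing_flip[of "{0}" ?u] assms by simp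
      ultimately show False by simp
    qed
  next
    assume "odd p"
    have "(x, y) \<in> rtrancl_on (verts ?G) ((arcs_ends ?G)\<^sup>s)"
      if "length x = d" "length y = d" for x y
    proof -
      have "flippable d p {i. i < length x \<and> x ! i \<noteq> y ! i}"
        using \<open>odd p\<close> assms that by (intro flippable_odd) auto
      then have "x \<rightarrow>\<^sup>*\<^bsub>?G\<^esub> y"
        unfolding flippable_def using flip_differing[of x y] that by metis
      then show ?thesis unfolding reachable_def
        \<comment> \<open>Directed reachability embeds into the symmetric closure.\<close>
        by (rule rtrancl_on_mono[rotated -1]) (auto simp: symcl_def)
    qed
    \<comment> \<open>Connectedness includes having at least one vertex.\<close>
    moreover have "verts ?G \<noteq> {}"
      using length_replicate[of d False] unfolding verts by blast
    ultimately show "Digraph_Component.connected ?G"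
      unfolding connected_conv verts by blast
  qed
qed

end
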